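(* For a finite group $X$ let $\sigma(X)$ denote the number of subgroups of $X$. For any finite group $G$, $$1=\sum_{H \leq G}\mu(H,G)\,\sigma(H).$$
   Context: $\mu$ is the Möbius function of the subgroup lattice of $G$: for subgroups $H, K$ of $G$, $\mu(H,K)=0$ unless $H\le K$, $\mu(H,H)=1$, and $\sum_{H\leq L\leq K}\mu(H,L)=0$ for $H<K$. *)

theory Defs
  imports "HOL-Algebra.Algebra"
begin

definition num_subgroups :: "('a, 'b) monoid_scheme \<Rightarrow> nat"
  where "num_subgroups G = card {H. subgroup H G}"

text \<open>
  The Moebius function of the subgroup lattice of a finite group, computed by recursion on the
  upper argument. The finiteness guard only makes the recursion total; the characteristic
  equations for finite groups are the three lemmas that follow.
\<close>

function subgroup_moebius :: "('a, 'b) monoid_scheme \<Rightarrow> 'a set \<Rightarrow> 'a set \<Rightarrow> int"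
  where "subgroup_moebius G H K =
    (if finite (carrier G) \<and> subgroup H G \<and> subgroup K G \<and> H \<subseteq> K
     then if H = K then 1
          else - (\<Sum>L | subgroup L G \<and> H \<subseteq> L \<and> L \<subset> K. subgroup_moebius G H L)
     else 0)"
  by pat_completeness auto
termination
proof (relation "measure (\<lambda>(G, H, K). card K)", goal_cases)
  case 1
  then show ?case by simp
next
  case (2 G H K L)
  then have "finite K"
    by (meson finite_subset subgroup.subset)
  moreover have "L \<subset> K"
    using 2 by simp
  ultimately show ?case by (simp add: psubset_card_mono)
qed

declare subgroup_moebius.simps [simp del]

lemma subgroup_moebius_not_le: "\<not> H \<subseteq> K \<Longrightarrow> subgroup_moebius G H K = 0"
  by (subst subgroup_moebius.simps) simp

lemma subgroup_moebius_refl: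
  assumes "finite (carrier G)" "subgroup H G"
  shows "subgroup_moebius G H H = 1"
  using assms by (subst subgroup_moebius.simps) simp

lemma subgroup_moebius_sum:
  assumes fin: "finite (carrier G)" and H: "subgroup H G" and K: "subgroup K G" and "H \<subset> K"
  shows "(\<Sum>L | subgroup L G \<and> H \<subseteq> L \<and> L \<subseteq> K. subgroup_moebius G H L) = 0"
proof -
  let ?A = "{L. subgroup L G \<and> H \<subseteq> L \<and> L \<subset> K}"
  have "?A \<subseteq> Pow (carrier G)"
    using subgroup.subset by blast
  then have "finite ?A"
    using fin by (meson finite_Pow_iff finite_subset)
  moreover have "{L. subgroup L G \<and> H \<subseteq> L \<and> L \<subseteq> K} = insert K ?A"
    using K \<open>H \<subset> K\<close> by auto
  moreover have "subgroup_moebius G H K = - (\<Sum>L\<in>?A. subgroup_moebius G H L)"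
    using assms psubset_imp_subset[OF \<open>H \<subset> K\<close>]
    by (subst subgroup_moebius.simps) (simp add: psubset_eq)
  ultimately show ?thesis by simp
qed

end

theory Submission
  imports Defs
begin

text \<open>
  Writing \<open>\<sigma>(H)\<close> as the number of \<open>K \<le> H\<close> and exchanging the two sums, the coefficient of
  a subgroup \<open>K\<close> is the sum of \<open>\<mu>(H, G)\<close> over \<open>K \<le> H \<le> G\<close>. The Moebius function is defined as the
  one-sided inverse of the zeta function that controls sums over the upper argument; being also the
  inverse on the other side, it makes that coefficient vanish unless \<open>K = G\<close>, where it is 1.
\<close>

lemma finite_subgroups:
  assumes "finite (carrier G)"
  shows "finite {H. subgroup H G}"
  by (rule finite_subset[of _ "Pow (carrier G)"]) (use assms in \<open>auto dest: subgroup.subset\<close>)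

text \<open>The recursion for \<mu> varies the upper argument; here the lower one varies. Induction
  on \<open>card H\<close>: expand each \<mu>(L, H) with L < H by the recursion and exchange the
  sums. The inner sum for a fixed M < H is then the same statement with M as upper end.\<close>

lemma sum_subgroup_moebius_upper:
  assumes fin: "finite (carrier G)" and K: "subgroup K G" and H: "subgroup H G" and "K \<subseteq> H"
  shows "(\<Sum>L | subgroup L G \<and> K \<subseteq> L \<and> L \<subseteq> H. subgroup_moebius G L H) = (if K = H then 1 else 0)"
  using H \<open>K \<subseteq> H\<close>
proof (induction "card H" arbitrary: H rule: less_induct)
  case less
  let ?\<mu> = "subgroup_moebius G"
  show ?case
  proof (cases "K = H")
    case True
    then have "{L. subgroup L G \<and> K \<subseteq> L \<and> L \<subseteq> H} = {H}"
      using K by auto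
    with True show ?thesis
      using fin K by (simp add: subgroup_moebius_refl)
  next
    case False
    let ?A = "{L. subgroup L G \<and> K \<subseteq> L \<and> L \<subset> H}"
    have finA: "finite ?A"
      by (rule finite_subset[OF _ finite_subgroups[OF fin]]) auto
    have finH: "finite H"
      using fin less.prems(1) by (meson finite_subset subgroup.subset)
    \<comment> \<open>K \<le> M follows from K \<le> L \<le> M, so M can range over
      \<open>?A\<close> as L does; this is the shape in which the double sum can be
      exchanged.\<close>
    have step: "?\<mu> L H = - (\<Sum>M | M \<in> ?A \<and> L \<subseteq> M. ?\<mu> L M)" if L: "L \<in> ?A" for L
    proof -
      have "?\<mu> L H = - (\<Sum>M | subgroup M G \<and> L \<subseteq> M \<and> M \<subset> H. ?\<mu> L M)"
        using fin less.prems(1) L by (subst subgroup_moebius.simps) auto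
      also have "{M. subgroup M G \<and> L \<subseteq> M \<and> M \<subset> H} = {M. M \<in> ?A \<and> L \<subseteq> M}"
        using L by auto
      finally show ?thesis .
    qed
    \<comment> \<open>As M < H, the bound L < H in \<open>?A\<close> is implied by L \<le> M, so the
      sum covers the whole interval from K to M.\<close>
    have IH: "(\<Sum>L | L \<in> ?A \<and> L \<subseteq> M. ?\<mu> L M) = (if K = M then 1 else 0)" if M: "M \<in> ?A" for M
    proof -
      have "{L. L \<in> ?A \<and> L \<subseteq> M} = {L. subgroup L G \<and> K \<subseteq> L \<and> L \<subseteq> M}"
        using M by auto
      moreover have "card M < card H"
        using M finH by (simp add: psubset_card_mono)
      ultimately show ?thesis
        using less.hyps[of M] M by simp
    qed
    have "{L. subgroup L G \<and> K \<subseteq> L \<and> L \<subseteq> H} = insert H ?A"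
      using less.prems by auto
    then have "(\<Sum>L | subgroup L G \<and> K \<subseteq> L \<and> L \<subseteq> H. ?\<mu> L H) = 1 + (\<Sum>L\<in>?A. ?\<mu> L H)"
      using finA fin less.prems(1) by (simp add: subgroup_moebius_refl)
    also have "(\<Sum>L\<in>?A. ?\<mu> L H) = - (\<Sum>L\<in>?A. \<Sum>M | M \<in> ?A \<and> L \<subseteq> M. ?\<mu> L M)"
      by (subst sum_negf[symmetric]) (rule sum.cong[OF refl step])
    also have "(\<Sum>L\<in>?A. \<Sum>M | M \<in> ?A \<and> L \<subseteq> M. ?\<mu> L M) = (\<Sum>M\<in>?A. \<Sum>L | L \<in> ?A \<and> L \<subseteq> M. ?\<mu> L M)"
      by (rule sum.swap_restrict[OF finA finA])
    also have "\<dots> = (\<Sum>M\<in>?A. if K = M then 1 else 0)"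
      by (rule sum.cong[OF refl IH])
    \<comment> \<open>K is a proper subgroup of H, hence itself in \<open>?A\<close>: exactly one
      term survives, and it cancels the 1 contributed by L = H.\<close>
    also have "\<dots> = 1"
      using finA K less.prems(2) False by (subst sum.delta') auto
    finally show ?thesis
      using False by simp
  qed
qed

text \<open>This turns \<sigma>(H), defined by H as a group of its own, into a count within the
  subgroup lattice of G.\<close>

lemma (in group) subgroups_of_subgroup:
  assumes "subgroup H G"
  shows "{K. subgroup K (G\<lparr>carrier := H\<rparr>)} = {K. subgroup K G \<and> K \<subseteq> H}"
proof (intro Collect_cong iffI conjI)
  fix K assume K: "subgroup K (G\<lparr>carrier := H\<rparr>)"
  show "subgroup K G"
    using assms K by (rule incl_subgroup)
  show "K \<subseteq> H"
    using subgroup.subset[OF K] by simp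
next
  fix K assume "subgroup K G \<and> K \<subseteq> H"
  then show "subgroup K (G\<lparr>carrier := H\<rparr>)"
    using assms by (blast intro: subgroup_incl)
qed

theorem proposition4:
  fixes G (structure)
  assumes "group G" and "finite (carrier G)"
  shows "1 = (\<Sum>H | subgroup H G.
               subgroup_moebius G H (carrier G) * int (num_subgroups (G\<lparr>carrier := H\<rparr>)))"
proof -
  interpret group G by fact
  let ?S = "{H. subgroup H G}" and ?\<mu> = "\<lambda>H. subgroup_moebius G H (carrier G)"
  have finS: "finite ?S"
    using assms(2) by (rule finite_subgroups)
  \<comment> \<open>The factor \<sigma>(H) becomes a sum of the constant \<mu>(H, G) over all K
    \<le> H.\<close>
  have "(\<Sum>H\<in>?S. ?\<mu> H * int (num_subgroups (G\<lparr>carrier := H\<rparr>)))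
      = (\<Sum>H\<in>?S. \<Sum>K | K \<in> ?S \<and> K \<subseteq> H. ?\<mu> H)"
    by (rule sum.cong) (simp_all add: num_subgroups_def subgroups_of_subgroup)
  also have "\<dots> = (\<Sum>K\<in>?S. \<Sum>H | H \<in> ?S \<and> K \<subseteq> H. ?\<mu> H)"
    by (rule sum.swap_restrict[OF finS finS])
  also have "\<dots> = (\<Sum>K\<in>?S. if K = carrier G then 1 else 0)"
  proof (rule sum.cong[OF refl])
    fix K assume "K \<in> ?S"
    then have "subgroup K G"
      by simp
    moreover have "{H. H \<in> ?S \<and> K \<subseteq> H} = {H. subgroup H G \<and> K \<subseteq> H \<and> H \<subseteq> carrier G}"
      by (auto dest: subgroup.subset)
    ultimately show "(\<Sum>H | H \<in> ?S \<and> K \<subseteq> H. ?\<mu> H) = (if K = carrier G then 1 else 0)"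
      using sum_subgroup_moebius_upper[OF assms(2) _ subgroup_self subgroup.subset, of K] by simp
  qed
  also have "\<dots> = 1"
    using finS subgroup_self by simp
  finally show ?thesis by simp
qed

end
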